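(* Let $f:(0,\infty)\to\mathbb{R}$ be convex, strictly convex at $1$, with $f(1)=0$. For all $w_1,w_2$ in the open unit disk $\mathbb{D}=\{w\in\mathbb{C}:|w|<1\}$, the $f$-divergence between the circular Cauchy distributions with parameters $w_1,w_2$ equals the $f$-divergence between the corresponding Cauchy distributions: $$I_f(p^{\mathrm{cc}}_{w_1}:p^{\mathrm{cc}}_{w_2})=I_f(p_{\theta(w_1)}:p_{\theta(w_2)}),\qquad \theta(w)=i\,\frac{1-w}{1+w}.$$ Consequently all $f$-divergences between circular Cauchy distributions are symmetric, $I_f(p^{\mathrm{cc}}_{w_1}:p^{\mathrm{cc}}_{w_2})=I_f(p^{\mathrm{cc}}_{w_2}:p^{\mathrm{cc}}_{w_1})$, and can be expressed as a scalar function (depending only on $f$) of the chi-squared divergence $\chi(\theta(w_1),\theta(w_2))$.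
   Context: For densities $p,q$ that are strictly positive on a common domain $\mathcal{X}$ (with respect to Lebesgue measure), $I_f(p:q):=\int_{\mathcal X}p\,f(q/p)\,dx$. The circular Cauchy density with parameter $w\in\mathbb{D}$ is $p^{\mathrm{cc}}_w(\phi)=\frac{1}{2\pi}\frac{1-|w|^2}{|e^{i\phi}-w|^2}$ for $\phi\in[-\pi,\pi)$, with respect to $d\phi$. For $\theta=l+is$ in the upper half-plane $\mathbb{H}$, the Cauchy density is $p_\theta(x)=\frac{\operatorname{Im}\theta}{\pi|x-\theta|^2}$, $x\in\mathbb{R}$. For $z,z'\in\mathbb{H}$, $\chi(z,z'):=\frac{|z-z'|^2}{2\operatorname{Im}(z)\operatorname{Im}(z')}$, which equals the chi-squared divergence $\int_{\mathbb{R}}\frac{(p_z-p_{z'})^2}{p_z}dx$ between $p_z$ and $p_{z'}$. *)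

theory Defs
  imports "HOL-Analysis.Analysis"
begin

definition strictly_convex_at :: "real set \<Rightarrow> (real \<Rightarrow> real) \<Rightarrow> real \<Rightarrow> bool" where
  "strictly_convex_at S f c \<longleftrightarrow>
     (\<forall>a\<in>S. \<forall>b\<in>S. \<forall>t. a \<noteq> b \<longrightarrow> 0 < t \<longrightarrow> t < 1 \<longrightarrow> (1 - t) * a + t * b = c \<longrightarrow>
        f c < (1 - t) * f a + t * f b)"

abbreviation f_div_integrand ::
    "(real \<Rightarrow> real) \<Rightarrow> (real \<Rightarrow> real) \<Rightarrow> (real \<Rightarrow> real) \<Rightarrow> real \<Rightarrow> real" where
  "f_div_integrand f p q \<equiv> (\<lambda>x. p x * f (q x / p x))"

text \<open>The Bochner integral below is 0 for a non-integrable integrand, so the value is meaningful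
  only together with \<open>f_div_exists\<close>.\<close>

definition f_div_exists ::
    "(real \<Rightarrow> real) \<Rightarrow> real set \<Rightarrow> (real \<Rightarrow> real) \<Rightarrow> (real \<Rightarrow> real) \<Rightarrow> bool" where
  "f_div_exists f X p q \<longleftrightarrow> set_integrable lborel X (f_div_integrand f p q)"

definition f_div ::
    "(real \<Rightarrow> real) \<Rightarrow> real set \<Rightarrow> (real \<Rightarrow> real) \<Rightarrow> (real \<Rightarrow> real) \<Rightarrow> real" where
  "f_div f X p q = set_lebesgue_integral lborel X (f_div_integrand f p q)"

definition circ_cauchy_density :: "complex \<Rightarrow> real \<Rightarrow> real" where
  "circ_cauchy_density w \<phi> = 1 / (2 * pi) * ((1 - (cmod w)\<^sup>2) / (cmod (cis \<phi> - w))\<^sup>2)"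

definition cauchy_density :: "complex \<Rightarrow> real \<Rightarrow> real" where
  "cauchy_density \<theta> x = Im \<theta> / (pi * (cmod (of_real x - \<theta>))\<^sup>2)"

definition cauchy_param :: "complex \<Rightarrow> complex" where
  "cauchy_param w = \<i> * ((1 - w) / (1 + w))"

text \<open>Closed form of the chi-squared divergence
  \<open>\<integral> (p\<^sub>z - p\<^sub>z\<^sub>')\<^sup>2 / p\<^sub>z\<close> between the Cauchy densities with parameters \<open>z\<close>, \<open>z'\<close>
  in the upper half-plane.\<close>

definition chi_sq :: "complex \<Rightarrow> complex \<Rightarrow> real" where
  "chi_sq z z' = (cmod (z - z'))\<^sup>2 / (2 * Im z * Im z')"

end

theory Submission
  imports Defs
begin

text \<open>The substitution \<open>x = tan (\<phi> / 2)\<close> is the boundary value of \<^const>\<open>cauchy_param\<close>; it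
  carries the circular Cauchy density with parameter \<open>w\<close> to the Cauchy density with parameter
  \<open>cauchy_param w\<close>, Jacobian included. On the line an affine map normalises the first parameter to
  \<open>\<i>\<close>, which corresponds to the centre \<open>0\<close> of the disk; there a rotation of the circle makes the
  second parameter \<open>w\<close> real and nonnegative, and \<open>\<bar>w\<bar>\<^sup>2 = \<chi> / (\<chi> + 2)\<close>. Symmetry follows from that
  of \<open>\<chi>\<close>.\<close>

section \<open>The conformal map from the disk to the half-plane and its boundary values\<close>

lemma Im_cauchy_param:
  "Im (cauchy_param w) = (1 - (cmod w)\<^sup>2) / (cmod (1 + w))\<^sup>2"
proof -
  have "Im (cauchy_param w) = ((1 - Re w) * (1 + Re w) - (Im w)\<^sup>2) / (cmod (1 + w))\<^sup>2"
    by (simp add: cauchy_param_def Im_divide cmod_power2) (simp add: power2_eq_square)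
  also have "(1 - Re w) * (1 + Re w) - (Im w)\<^sup>2 = 1 - (cmod w)\<^sup>2"
    unfolding cmod_power2 by (simp add: power2_eq_square algebra_simps)
  finally show ?thesis .
qed

lemma one_plus_nonzero:
  assumes "cmod w < 1"
  shows "1 + w \<noteq> 0"
  using assms by (metis add_eq_0_iff norm_minus_cancel norm_one order_less_irrefl)

lemma Im_cauchy_param_pos:
  assumes "cmod w < 1"
  shows "Im (cauchy_param w) > 0"
  using assms one_plus_nonzero[OF assms]
  by (simp add: Im_cauchy_param abs_square_less_1)

text \<open>The map is inverted by the Cayley transform. Dividing by \<bar>\<i> + z\<bar>^2 =
  \<bar>\<i> - z\<bar>^2 + 4 Im z gives both the bound on \<open>cmod w\<close> and its expression
  through \<open>chi_sq \<i> z\<close>, where \<bar>\<i> - z\<bar>^2 is 2 Im z times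
  \<open>chi_sq \<i> z\<close>.\<close>

lemma cauchy_param_surj:
  assumes "Im z > 0"
  obtains w where "cmod w < 1" "cauchy_param w = z"
    "(cmod w)\<^sup>2 = chi_sq \<i> z / (chi_sq \<i> z + 2)"
proof -
  define w where "w = (\<i> - z) / (\<i> + z)"
  have nz: "\<i> + z \<noteq> 0"
    using assms by (auto simp: complex_eq_iff)
  have eq: "(cmod (\<i> + z))\<^sup>2 = (cmod (\<i> - z))\<^sup>2 + 4 * Im z"
    unfolding cmod_power2 by (simp add: power2_eq_square algebra_simps)
  have w2: "(cmod w)\<^sup>2 = (cmod (\<i> - z))\<^sup>2 / ((cmod (\<i> - z))\<^sup>2 + 4 * Im z)"
    by (simp add: w_def norm_divide power_divide eq)
  have "(cmod w)\<^sup>2 < 1"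
    unfolding w2 using assms by (subst divide_less_eq_1_pos) (auto intro: add_nonneg_pos)
  then have 1: "cmod w < 1"
    by (simp add: abs_square_less_1)
  have "1 - w = 2 * z / (\<i> + z)" "1 + w = 2 * \<i> / (\<i> + z)"
    using nz by (simp_all add: w_def field_simps)
  then have 2: "cauchy_param w = z"
    using nz by (simp add: cauchy_param_def)
  have "(cmod w)\<^sup>2 = chi_sq \<i> z / (chi_sq \<i> z + 2)"
    unfolding w2 chi_sq_def using assms by (simp add: divide_simps)
  with 1 2 show ?thesis by (rule that)
qed

text \<open>The unit circle goes to the real line. The assumption keeps \<open>cis \<phi>\<close>
  away from the pole -1.\<close>

lemma cauchy_param_cis:
  assumes "cos \<phi> \<noteq> - 1"
  shows "cauchy_param (cis \<phi>) = of_real (tan (\<phi> / 2))"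
proof -
  have nz: "1 + cis \<phi> \<noteq> 0"
    using assms by (auto simp: complex_eq_iff)
  have t: "tan (\<phi> / 2) * (1 + cos \<phi>) = sin \<phi>"
    using tan_half[of "\<phi> / 2"] assms by (simp add: field_simps add_eq_0_iff)
  have "tan (\<phi> / 2) * sin \<phi> * (1 + cos \<phi>) = (1 - cos \<phi>) * (1 + cos \<phi>)"
    using t sin_squared_eq[of \<phi>] by (simp add: power2_eq_square algebra_simps) 
  then have "tan (\<phi> / 2) * sin \<phi> = 1 - cos \<phi>"
    using assms by (simp add: add_eq_0_iff)
  with t have "\<i> * (1 - cis \<phi>) = of_real (tan (\<phi> / 2)) * (1 + cis \<phi>)"
    by (simp add: complex_eq_iff)
  then show ?thesis
    using nz by (simp add: cauchy_param_def field_simps)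
qed

text \<open>For u on the circle, this turns the distance in the Cauchy density into the distance in
  the circular one.\<close>

lemma cauchy_param_diff:
  assumes "1 + u \<noteq> 0" "1 + w \<noteq> 0"
  shows "cauchy_param u - cauchy_param w = 2 * \<i> * (w - u) / ((1 + u) * (1 + w))"
  using assms by (simp add: cauchy_param_def divide_simps) (simp add: algebra_simps)

section \<open>Densities under the half-angle substitution, their positivity and continuity\<close>

text \<open>The first factor is the derivative of tan (\<phi> / 2). The powers of \<bar>1 + w\<bar>
  in the imaginary part and in the squared distance cancel.\<close>

lemma circ_cauchy_density_eq:
  assumes w: "cmod w < 1" and \<phi>: "\<phi> \<in> {-pi<..<pi}"
  shows "circ_cauchy_density w \<phi> =
    inverse (2 * (cos (\<phi> / 2))\<^sup>2) * cauchy_density (cauchy_param w) (tan (\<phi> / 2))"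
proof -
  have c: "cos (\<phi> / 2) > 0"
    using \<phi> by (intro cos_gt_zero_pi) auto
  have cos: "cos \<phi> = 2 * (cos (\<phi> / 2))\<^sup>2 - 1"
    using cos_double_cos[of "\<phi> / 2"] by simp
  with c have ne: "cos \<phi> \<noteq> -1"
    by simp
  then have nz: "1 + cis \<phi> \<noteq> 0"
    by (auto simp: complex_eq_iff)
  have "(cmod (1 + cis \<phi>))\<^sup>2 = 2 + 2 * cos \<phi>"
    unfolding cmod_power2 using sin_cos_squared_add[of \<phi>]
    by (simp add: power2_eq_square algebra_simps)
  then have u: "(cmod (1 + cis \<phi>))\<^sup>2 = 4 * (cos (\<phi> / 2))\<^sup>2"
    by (simp add: cos)
  have "cmod (of_real (tan (\<phi> / 2)) - cauchy_param w)
      = 2 * cmod (cis \<phi> - w) / (cmod (1 + cis \<phi>) * cmod (1 + w))"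
    using cauchy_param_diff[OF nz one_plus_nonzero[OF w]]
    by (simp add: cauchy_param_cis[OF ne] norm_mult norm_divide norm_minus_commute)
  then have d: "(cmod (of_real (tan (\<phi> / 2)) - cauchy_param w))\<^sup>2
      = (cmod (cis \<phi> - w))\<^sup>2 / ((cos (\<phi> / 2))\<^sup>2 * (cmod (1 + w))\<^sup>2)"
    by (simp add: power_divide power_mult_distrib u)
  \<comment> \<open>Here N = 1 - \<bar>w\<bar>^2, D = \<bar>cis \<phi> - w\<bar>^2, C = cos (\<phi>
    / 2)^2 and W = \<bar>1 + w\<bar>^2.\<close>
  have "1 / (2 * pi) * (N / D) = inverse (2 * C) * (N / W / (pi * (D / (C * W))))"
    if "C > 0" "W > 0" for N D C W :: real
    using that by (simp add: field_simps)
  then show ?thesis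
    unfolding circ_cauchy_density_def cauchy_density_def d Im_cauchy_param
    using c one_plus_nonzero[OF w] by simp
qed

lemma circ_cauchy_density_pos:
  assumes "cmod w < 1"
  shows "circ_cauchy_density w \<phi> > 0"
proof -
  have "cis \<phi> \<noteq> w"
    using assms by auto
  then show ?thesis
    using assms by (auto simp: circ_cauchy_density_def abs_square_less_1 intro!: divide_pos_pos)
qed

lemma cauchy_density_pos:
  assumes "Im z > 0"
  shows "cauchy_density z x > 0"
proof -
  have "of_real x \<noteq> z"
    using assms by auto
  then show ?thesis
    using assms by (auto simp: cauchy_density_def intro!: divide_pos_pos)
qed

text \<open>A convex function on an open interval is continuous, and the ratio of two positive
  densities stays in that interval.\<close>

lemma continuous_on_f_div_integrand:
  assumes f: "convex_on {0<..} f"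
    and p: "continuous_on S p" "\<And>x. x \<in> S \<Longrightarrow> p x > 0"
    and q: "continuous_on S q" "\<And>x. x \<in> S \<Longrightarrow> q x > 0"
  shows "continuous_on S (f_div_integrand f p q)"
proof -
  have "continuous_on S (f \<circ> (\<lambda>x. q x / p x))"
  proof (rule continuous_on_compose)
    show "continuous_on S (\<lambda>x. q x / p x)"
      using p q by (intro continuous_intros) (auto simp: less_imp_neq[THEN not_sym])
    have "continuous_on {0<..} f"
      using f by (intro convex_on_continuous) auto
    then show "continuous_on ((\<lambda>x. q x / p x) ` S) f"
      by (rule continuous_on_subset) (use p q in auto)
  qed
  with p show ?thesis
    by (auto simp: o_def intro!: continuous_intros)
qed

lemma continuous_on_circ_cauchy_density:
  assumes "cmod w < 1"
  shows "continuous_on S (circ_cauchy_density w)"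
proof -
  have "cis \<phi> \<noteq> w" for \<phi>
    using assms by auto
  then show ?thesis
    unfolding circ_cauchy_density_def by (auto intro!: continuous_intros)
qed

lemma continuous_on_cauchy_density:
  assumes "Im z > 0"
  shows "continuous_on S (cauchy_density z)"
proof -
  have "of_real x \<noteq> z" for x
    using assms by auto
  then show ?thesis
    unfolding cauchy_density_def by (auto intro!: continuous_intros)
qed

lemma continuous_on_circ_integrand:
  assumes "convex_on {0<..} f" "cmod w1 < 1" "cmod w2 < 1"
  shows "continuous_on S (f_div_integrand f (circ_cauchy_density w1) (circ_cauchy_density w2))"
  using assms by (intro continuous_on_f_div_integrand continuous_on_circ_cauchy_density
      circ_cauchy_density_pos)

lemma continuous_on_cauchy_integrand:
  assumes "convex_on {0<..} f" "Im z1 > 0" "Im z2 > 0"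
  shows "continuous_on S (f_div_integrand f (cauchy_density z1) (cauchy_density z2))"
  using assms by (intro continuous_on_f_div_integrand continuous_on_cauchy_density
      cauchy_density_pos)

section \<open>Integrability and equality of the two divergences\<close>

text \<open>The divergences are integrals over \<open>lborel\<close>, while change of variables and
  interval splitting speak of the Lebesgue completion and the gauge integral. For Borel functions
  the values agree.\<close>

lemma set_integral_lborel_eq_integral:
  fixes g :: "real \<Rightarrow> real"
  assumes S: "S \<in> sets borel" and g: "g \<in> borel_measurable borel"
    and int: "g absolutely_integrable_on S"
  shows "set_integrable lborel S g" "set_lebesgue_integral lborel S g = integral S g"
proof -
  have [measurable]: "(\<lambda>x. indicator S x *\<^sub>R g x) \<in> borel_measurable lborel"
    using S g by simp
  show "set_integrable lborel S g"
    using int by (simp add: set_integrable_def integrable_completion del: real_scaleR_def)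
  have "set_lebesgue_integral lborel S g = set_lebesgue_integral lebesgue S g"
    by (simp add: set_lebesgue_integral_def integral_completion del: real_scaleR_def)
  with int show "set_lebesgue_integral lborel S g = integral S g"
    by (simp add: set_lebesgue_integral_eq_integral)
qed

text \<open>The integrand is continuous on the whole line, hence integrable on the compact interval,
  and endpoints are null. The closed interval serves the rotation argument, the open one is where
  tan (\<phi> / 2) is a bijection onto the line.\<close>

lemma circ_f_div:
  assumes "convex_on {0<..} f" "cmod w1 < 1" "cmod w2 < 1"
  defines "g \<equiv> f_div_integrand f (circ_cauchy_density w1) (circ_cauchy_density w2)"
  shows "f_div_exists f {-pi..<pi} (circ_cauchy_density w1) (circ_cauchy_density w2)"
    and "f_div f {-pi..<pi} (circ_cauchy_density w1) (circ_cauchy_density w2) = integral {-pi..pi} g"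
    and "g absolutely_integrable_on {-pi<..<pi}"
proof -
  have cont: "continuous_on S g" for S
    unfolding g_def using assms by (intro continuous_on_circ_integrand)
  have int: "g absolutely_integrable_on {-pi..pi}"
    by (intro absolutely_integrable_continuous_real cont)
  then show "g absolutely_integrable_on {-pi<..<pi}"
    by (rule set_integrable_subset) auto
  have "g absolutely_integrable_on {-pi..<pi}"
    using int by (rule set_integrable_subset) auto
  note * = set_integral_lborel_eq_integral[OF _ borel_measurable_continuous_onI[OF cont] this]
  show "f_div_exists f {-pi..<pi} (circ_cauchy_density w1) (circ_cauchy_density w2)"
    unfolding f_div_exists_def using *(1) by (simp add: g_def)
  have "integral {-pi..<pi} g = integral {-pi..pi} g"
    by (rule integral_subset_negligible) (auto intro: negligible_subset[of "{pi}"])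
  then show "f_div f {-pi..<pi} (circ_cauchy_density w1) (circ_cauchy_density w2)
      = integral {-pi..pi} g"
    unfolding f_div_def using *(2) by (simp add: g_def)
qed

lemma tan_half_image: "(\<lambda>\<phi>. tan (\<phi> / 2)) ` {-pi<..<pi} = UNIV"
proof -
  have "\<exists>\<phi>\<in>{-pi<..<pi}. x = tan (\<phi> / 2)" for x
    using arctan_bounded[of x] by (intro bexI[of _ "2 * arctan x"]) (auto simp: tan_arctan)
  then show ?thesis
    by auto
qed

lemma f_div_circ_eq_cauchy:
  assumes f: "convex_on {0<..} f" and w: "cmod w1 < 1" "cmod w2 < 1"
  shows "f_div_exists f UNIV (cauchy_density (cauchy_param w1)) (cauchy_density (cauchy_param w2))"
    and "f_div f {-pi..<pi} (circ_cauchy_density w1) (circ_cauchy_density w2)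
      = f_div f UNIV (cauchy_density (cauchy_param w1)) (cauchy_density (cauchy_param w2))"
proof -
  define g where "g = f_div_integrand f (circ_cauchy_density w1) (circ_cauchy_density w2)"
  define k where "k = f_div_integrand f (cauchy_density (cauchy_param w1))
    (cauchy_density (cauchy_param w2))"
  define J where "J = (\<lambda>\<phi>. inverse (2 * (cos (\<phi> / 2))\<^sup>2) :: real)"
  have J: "J \<phi> > 0" if "\<phi> \<in> {-pi<..<pi}" for \<phi>
    using that cos_gt_zero_pi[of "\<phi> / 2"] by (auto simp: J_def)
  have der: "((\<lambda>\<phi>. tan (\<phi> / 2)) has_field_derivative J \<phi>) (at \<phi> within {-pi<..<pi})"
    if "\<phi> \<in> {-pi<..<pi}" for \<phi>
    using that cos_gt_zero_pi[of "\<phi> / 2"]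
    by (auto simp: J_def field_simps intro!: derivative_eq_intros)
  have inj: "inj_on (\<lambda>\<phi>. tan (\<phi> / 2)) {-pi<..<pi}"
  proof (rule inj_on_inverseI)
    show "2 * arctan (tan (\<phi> / 2)) = \<phi>" if "\<phi> \<in> {-pi<..<pi}" for \<phi>
      using that by (subst arctan_tan) auto
  qed
  have dens: "circ_cauchy_density w \<phi> = J \<phi> * cauchy_density (cauchy_param w) (tan (\<phi> / 2))"
    if "cmod w < 1" "\<phi> \<in> {-pi<..<pi}" for w \<phi>
    unfolding J_def using that by (rule circ_cauchy_density_eq)
  \<comment> \<open>The Jacobian cancels in the ratio of the densities and survives only in the
    outer factor.\<close>
  have g_eq: "g \<phi> = \<bar>J \<phi>\<bar> * k (tan (\<phi> / 2))" if "\<phi> \<in> {-pi<..<pi}" for \<phi>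
    using that J[OF that] w
    by (simp add: g_def k_def dens)
  have "g absolutely_integrable_on {-pi<..<pi}"
    unfolding g_def using assms by (rule circ_f_div)
  moreover have "g absolutely_integrable_on {-pi<..<pi} \<longleftrightarrow>
      (\<lambda>\<phi>. \<bar>J \<phi>\<bar> * k (tan (\<phi> / 2))) absolutely_integrable_on {-pi<..<pi}"
    by (intro set_integrable_cong refl g_eq)
  moreover have "integral {-pi<..<pi} g = integral {-pi<..<pi} (\<lambda>\<phi>. \<bar>J \<phi>\<bar> * k (tan (\<phi> / 2)))"
    by (intro Henstock_Kurzweil_Integration.integral_cong g_eq)
  \<comment> \<open>The change of variables is an equivalence, so integrability passes from the
    circle to the unbounded line together with the value.\<close>
  ultimately have k: "k absolutely_integrable_on UNIV" "integral UNIV k = integral {-pi<..<pi} g"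
    using has_absolute_integral_change_of_variables_1'[OF _ der inj, of k "integral {-pi<..<pi} g"]
    by (simp_all add: tan_half_image)
  have "continuous_on UNIV k"
    unfolding k_def using assms by (intro continuous_on_cauchy_integrand Im_cauchy_param_pos)
  note * = set_integral_lborel_eq_integral[OF _ borel_measurable_continuous_onI[OF this] k(1)]
  show "f_div_exists f UNIV (cauchy_density (cauchy_param w1)) (cauchy_density (cauchy_param w2))"
    unfolding f_div_exists_def using *(1) by (simp add: k_def)
  have "f_div f {-pi..<pi} (circ_cauchy_density w1) (circ_cauchy_density w2) = integral {-pi<..<pi} g"
    unfolding g_def using circ_f_div(2)[OF assms] by (simp add: integral_open_interval_real)
  with *(2) show "f_div f {-pi..<pi} (circ_cauchy_density w1) (circ_cauchy_density w2)
      = f_div f UNIV (cauchy_density (cauchy_param w1)) (cauchy_density (cauchy_param w2))"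
    unfolding f_div_def by (simp add: k_def k(2)[unfolded k_def])
qed

section \<open>Invariance under affine maps of the line and rotations of the circle\<close>

lemma cauchy_density_affine:
  assumes "s > 0"
  shows "cauchy_density ((z - of_real l) / of_real s) x = s * cauchy_density z (l + s * x)"
proof -
  have "of_real (l + s * x) - z = of_real s * (of_real x - (z - of_real l) / of_real s)"
    using assms by (simp add: field_simps)
  then have "(cmod (of_real (l + s * x) - z))\<^sup>2
      = s\<^sup>2 * (cmod (of_real x - (z - of_real l) / of_real s))\<^sup>2"
    by (simp only: norm_mult power_mult_distrib) simp
  then show ?thesis
    using assms by (simp add: cauchy_density_def power2_eq_square)
qed

text \<open>Substituting l + s * x produces one factor s; on the other side the densities carry s,
  which cancels in their ratio and remains once in front.\<close>

lemma f_div_cauchy_affine: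
  assumes s: "s > 0"
  shows "f_div f UNIV (cauchy_density z1) (cauchy_density z2)
    = f_div f UNIV (cauchy_density ((z1 - of_real l) / of_real s))
        (cauchy_density ((z2 - of_real l) / of_real s))"
  unfolding f_div_def set_lebesgue_integral_def cauchy_density_affine[OF s]
  using s by (subst lborel_integral_real_affine[of s _ l]) (simp_all add: mult.assoc)

lemma integral_periodic_shift:
  fixes g :: "real \<Rightarrow> real"
  assumes cont: "continuous_on UNIV g" and per: "\<And>x. g (x + p) = g x"
    and a: "0 \<le> a" "a \<le> p"
  shows "integral {b..b + p} (\<lambda>x. g (x + a)) = integral {b..b + p} g"
proof -
  have int: "g integrable_on {c..d}" for c d
    by (intro integrable_continuous_real continuous_on_subset[OF cont]) auto
  have "integral {b..b + p} (\<lambda>x. g (x + a)) = integral {b + a..b + p + a} g"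
    using integral_shift_real_ivl[of "b + a" a "b + p + a" g] by simp
  also have "\<dots> = integral {b + a..b + p} g + integral {b + p..b + p + a} g"
    using a by (intro Henstock_Kurzweil_Integration.integral_combine[symmetric] int) auto
  \<comment> \<open>The piece beyond the period is moved back to its start.\<close>
  also have "integral {b + p..b + p + a} g = integral {b..b + a} g"
    using integral_shift_real_ivl[of "b + p" p "b + p + a" g] by (simp add: per)
  also have "integral {b + a..b + p} g + integral {b..b + a} g = integral {b..b + p} g"
    using Henstock_Kurzweil_Integration.integral_combine[of b "b + a" "b + p" g] a int by simp
  finally show ?thesis .
qed

lemma circ_cauchy_density_rotate:
  "circ_cauchy_density (cis \<alpha> * w) (\<phi> + \<alpha>) = circ_cauchy_density w \<phi>"
proof -
  have "cis (\<phi> + \<alpha>) - cis \<alpha> * w = cis \<alpha> * (cis \<phi> - w)"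
    by (simp add: cis_mult algebra_simps)
  then show ?thesis
    by (simp add: circ_cauchy_density_def norm_mult)
qed

text \<open>Rotating both parameters shifts the integrand, and an integral over a full period
  ignores shifts.\<close>

lemma f_div_circ_cauchy_rotate:
  assumes f: "convex_on {0<..} f" and w: "cmod w1 < 1" "cmod w2 < 1"
    and \<alpha>: "0 \<le> \<alpha>" "\<alpha> \<le> 2 * pi"
  shows "f_div f {-pi..<pi} (circ_cauchy_density (cis \<alpha> * w1)) (circ_cauchy_density (cis \<alpha> * w2))
    = f_div f {-pi..<pi} (circ_cauchy_density w1) (circ_cauchy_density w2)"
proof -
  define g where "g = f_div_integrand f (circ_cauchy_density (cis \<alpha> * w1))
    (circ_cauchy_density (cis \<alpha> * w2))"
  have w': "cmod (cis \<alpha> * w1) < 1" "cmod (cis \<alpha> * w2) < 1"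
    using w by (simp_all add: norm_mult)
  have "continuous_on UNIV g"
    unfolding g_def using f w' by (intro continuous_on_circ_integrand)
  moreover have "g (x + 2 * pi) = g x" for x
    by (simp add: g_def circ_cauchy_density_def flip: cis_mult)
  ultimately have "integral {-pi..-pi + 2 * pi} (\<lambda>x. g (x + \<alpha>)) = integral {-pi..-pi + 2 * pi} g"
    using \<alpha> by (rule integral_periodic_shift)
  then show ?thesis
    unfolding circ_f_div(2)[OF f w] circ_f_div(2)[OF f w']
    by (simp add: g_def circ_cauchy_density_rotate)
qed

text \<open>Rotations fix the parameter 0, so the argument of w can be removed.\<close>

lemma f_div_circ_cauchy_radial:
  assumes f: "convex_on {0<..} f" and w: "cmod w < 1"
  shows "f_div f {-pi..<pi} (circ_cauchy_density 0) (circ_cauchy_density w)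
    = f_div f {-pi..<pi} (circ_cauchy_density 0) (circ_cauchy_density (of_real (cmod w)))"
proof -
  have "w = cis (Arg2pi w) * of_real (cmod w)"
    using Arg2pi_eq[of w] by (simp add: cis_conv_exp mult.commute)
  then show ?thesis
    using f_div_circ_cauchy_rotate[OF f, of 0 "of_real (cmod w)" "Arg2pi w"] w
      Arg2pi_ge_0[of w] Arg2pi_lt_2pi[of w] by simp
qed

section \<open>Reduction to the chi-squared divergence\<close>

text \<open>The square root is the modulus of the second disk parameter once the first has been
  moved to 0.\<close>

lemma f_div_cauchy_eq_chi_sq:
  assumes f: "convex_on {0<..} f" and z: "Im z1 > 0" "Im z2 > 0"
  shows "f_div f UNIV (cauchy_density z1) (cauchy_density z2)
    = f_div f {-pi..<pi} (circ_cauchy_density 0)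
        (circ_cauchy_density (of_real (sqrt (chi_sq z1 z2 / (chi_sq z1 z2 + 2)))))"
proof -
  define T :: "complex \<Rightarrow> complex"
    where "T z = (z - of_real (Re z1)) / of_real (Im z1)" for z
  have "Im (T z2) > 0"
    using z by (simp add: T_def)
  then obtain w where w: "cmod w < 1" "cauchy_param w = T z2"
    "(cmod w)\<^sup>2 = chi_sq \<i> (T z2) / (chi_sq \<i> (T z2) + 2)"
    by (rule cauchy_param_surj)
  have T1: "T z1 = \<i>"
    using z by (simp add: T_def complex_eq_iff)
  have "T z1 - T z2 = (z1 - z2) / of_real (Im z1)"
    by (simp add: T_def flip: diff_divide_distrib)
  then have "(cmod (\<i> - T z2))\<^sup>2 = (cmod (z1 - z2))\<^sup>2 / (Im z1)\<^sup>2"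
    by (simp add: T1 norm_divide power_divide)
  \<comment> \<open>\<open>chi_sq\<close> is affine invariant: squared distance and product of
    imaginary parts both scale by 1 / (Im z1)^2.\<close>
  then have "chi_sq \<i> (T z2) = chi_sq z1 z2"
    using z by (simp add: chi_sq_def T_def power2_eq_square)
  with w(3) have cw: "cmod w = sqrt (chi_sq z1 z2 / (chi_sq z1 z2 + 2))"
    by (metis norm_ge_zero real_sqrt_unique)
  have "f_div f UNIV (cauchy_density z1) (cauchy_density z2)
      = f_div f UNIV (cauchy_density (T z1)) (cauchy_density (T z2))"
    unfolding T_def using z(1) by (rule f_div_cauchy_affine)
  also have "\<dots> = f_div f UNIV (cauchy_density (cauchy_param 0)) (cauchy_density (cauchy_param w))"
    using w(2) by (simp add: T1 cauchy_param_def)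
  also have "\<dots> = f_div f {-pi..<pi} (circ_cauchy_density 0) (circ_cauchy_density w)"
    using f_div_circ_eq_cauchy(2)[OF f, of 0 w] w(1) by simp
  finally show ?thesis
    unfolding f_div_circ_cauchy_radial[OF f w(1)] cw .
qed

theorem theorem4:
  fixes f :: "real \<Rightarrow> real"
  assumes "convex_on {0<..} f"
    and "strictly_convex_at {0<..} f 1"
    and "f 1 = 0"
  shows "(\<forall>w1 w2. cmod w1 < 1 \<longrightarrow> cmod w2 < 1 \<longrightarrow>
            f_div_exists f {-pi..<pi} (circ_cauchy_density w1) (circ_cauchy_density w2) \<and>
            f_div_exists f UNIV (cauchy_density (cauchy_param w1)) (cauchy_density (cauchy_param w2)) \<and>
            f_div f {-pi..<pi} (circ_cauchy_density w1) (circ_cauchy_density w2)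
              = f_div f UNIV (cauchy_density (cauchy_param w1)) (cauchy_density (cauchy_param w2)))
       \<and> (\<forall>w1 w2. cmod w1 < 1 \<longrightarrow> cmod w2 < 1 \<longrightarrow>
            f_div f {-pi..<pi} (circ_cauchy_density w1) (circ_cauchy_density w2)
              = f_div f {-pi..<pi} (circ_cauchy_density w2) (circ_cauchy_density w1))
       \<and> (\<exists>h :: real \<Rightarrow> real. \<forall>w1 w2. cmod w1 < 1 \<longrightarrow> cmod w2 < 1 \<longrightarrow>
            f_div f {-pi..<pi} (circ_cauchy_density w1) (circ_cauchy_density w2)
              = h (chi_sq (cauchy_param w1) (cauchy_param w2)))"
proof -
  note f = assms(1)
  \<comment> \<open>This is the divergence from the uniform density to the one of radius r, where c
    = 2 r^2 / (1 - r^2) is solved for r.\<close>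
  define h where "h c = f_div f {-pi..<pi} (circ_cauchy_density 0)
    (circ_cauchy_density (of_real (sqrt (c / (c + 2)))))" for c
  have h: "f_div f {-pi..<pi} (circ_cauchy_density w1) (circ_cauchy_density w2)
      = h (chi_sq (cauchy_param w1) (cauchy_param w2))" if "cmod w1 < 1" "cmod w2 < 1" for w1 w2
    unfolding h_def f_div_circ_eq_cauchy(2)[OF f that]
    using that by (intro f_div_cauchy_eq_chi_sq f Im_cauchy_param_pos)
  have sym: "chi_sq z z' = chi_sq z' z" for z z'
    by (simp add: chi_sq_def norm_minus_commute mult.commute mult.left_commute)
  show ?thesis
    using circ_f_div(1)[OF f] f_div_circ_eq_cauchy[OF f] h sym by metis
qed

end
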